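(* Let $G\subset\Gamma$ be a rational group, i.e. a subgroup of $\Gamma$ generated as a group by elements of $\mathfrak{RS}$. If every rational non-cyclic subsemigroup of $G$ is right amenable, then $G$ is amenable.
   Context: $\mathfrak{S}$ is the semigroup, under composition (substitution), of all formal power series $a_1z+a_2z^2+\dots$ in one variable with $a_i\in\mathbb{C}$. $\Gamma=\{s\in\mathfrak{S}: a_1\neq 0\}$ is the group of invertible elements of $\mathfrak{S}$. An element of $\mathfrak{S}$ is called rational if it has positive radius of convergence and converges to a rational function; $\mathfrak{RS}\subset\mathfrak{S}$ is the subsemigroup of all rational elements. A semigroup contained in $\mathfrak{S}$ is called rational if it is generated as a semigroup by elements of $\mathfrak{RS}$. A semigroup $S$ is right amenable if there is a finitely additive probability measure $\mu$ defined on all subsets of $S$ with $\mu(r_\gamma^{-1}(A))=\mu(A)$ for all $A\subset S$, $\gamma\in S$, where $r_\gamma(g)=g\gamma$. Amenability of $G$ is amenability as a discrete (abstract) group. *)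

theory Defs
  imports
    "HOL-Analysis.FPS_Convergence"
    "HOL-Analysis.Measure_Space"
    "HOL-Algebra.Generated_Groups"
begin

definition formal_monoid :: "complex fps monoid" where
  "formal_monoid =
    \<lparr>carrier = {s. fps_nth s 0 = 0}, monoid.mult = (\<lambda>s t. fps_compose s t), one = fps_X\<rparr>"

definition formal_group :: "complex fps monoid" where
  "formal_group = formal_monoid\<lparr>carrier := {s \<in> carrier formal_monoid. fps_nth s 1 \<noteq> 0}\<rparr>"

text \<open>A rational element: the series has positive radius of convergence and its sum is a quotient
  of polynomials \<open>p / q\<close>. Asking that \<open>q\<close> has no zero in the disc of convergence is no
  restriction, as one may take \<open>p\<close> and \<open>q\<close> coprime; it rules out \<open>q = 0\<close> and
  spurious agreement through division by zero.\<close>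

definition rational_elements :: "complex fps set" where
  "rational_elements = {s \<in> carrier formal_monoid.
     fps_conv_radius s > 0 \<and>
     (\<exists>p q. \<forall>z \<in> eball 0 (fps_conv_radius s).
        poly q z \<noteq> 0 \<and> eval_fps s z = poly p z / poly q z)}"

inductive_set semigroup_generate :: "('a, 'b) monoid_scheme \<Rightarrow> 'a set \<Rightarrow> 'a set"
  for M (structure) and X where
  base: "x \<in> X \<Longrightarrow> x \<in> semigroup_generate M X"
| mult: "\<lbrakk>x \<in> semigroup_generate M X; y \<in> semigroup_generate M X\<rbrakk>
    \<Longrightarrow> x \<otimes> y \<in> semigroup_generate M X"

text \<open>Semigroups are nonempty, so the generating set of a rational semigroup is required to be
  nonempty. (The empty set carries no probability measure, hence would not be right amenable.)\<close>

definition rational_semigroup :: "complex fps set \<Rightarrow> bool" where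
  "rational_semigroup S \<longleftrightarrow>
     (\<exists>X. X \<noteq> {} \<and> X \<subseteq> rational_elements \<and> S = semigroup_generate formal_monoid X)"

definition cyclic_semigroup :: "complex fps set \<Rightarrow> bool" where
  "cyclic_semigroup S \<longleftrightarrow>
     (\<exists>x \<in> carrier formal_monoid. S = semigroup_generate formal_monoid {x})"

definition rational_group :: "complex fps set \<Rightarrow> bool" where
  "rational_group G \<longleftrightarrow>
     subgroup G formal_group \<and>
     (\<exists>X. X \<subseteq> rational_elements \<inter> carrier formal_group \<and> G = generate formal_group X)"

definition finitely_additive_probability :: "'a set \<Rightarrow> ('a set \<Rightarrow> real) \<Rightarrow> bool" where
  "finitely_additive_probability S \<mu> \<longleftrightarrow>
     (\<forall>A \<subseteq> S. 0 \<le> \<mu> A) \<and> \<mu> S = 1 \<and> additive (Pow S) \<mu>"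

definition right_amenable :: "('a, 'b) monoid_scheme \<Rightarrow> bool" where
  "right_amenable S \<longleftrightarrow>
     (\<exists>\<mu>. finitely_additive_probability (carrier S) \<mu> \<and>
       (\<forall>A \<subseteq> carrier S. \<forall>\<gamma> \<in> carrier S. \<mu> {g \<in> carrier S. g \<otimes>\<^bsub>S\<^esub> \<gamma> \<in> A} = \<mu> A))"

definition left_amenable :: "('a, 'b) monoid_scheme \<Rightarrow> bool" where
  "left_amenable S \<longleftrightarrow>
     (\<exists>\<mu>. finitely_additive_probability (carrier S) \<mu> \<and>
       (\<forall>A \<subseteq> carrier S. \<forall>\<gamma> \<in> carrier S. \<mu> {g \<in> carrier S. \<gamma> \<otimes>\<^bsub>S\<^esub> g \<in> A} = \<mu> A))"

text \<open>For a group the two conditions are equivalent, by transport along inversion, and either one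
  is the usual amenability of the underlying discrete group.\<close>

definition amenable :: "('a, 'b) monoid_scheme \<Rightarrow> bool" where
  "amenable S \<longleftrightarrow> left_amenable S \<and> right_amenable S"

lemma fps_compose_nth_1:
  fixes s t :: "complex fps"
  assumes "fps_nth t 0 = 0"
  shows "fps_nth (fps_compose s t) 1 = fps_nth s 1 * fps_nth t 1"
  using assms by (simp add: fps_compose_nth)

lemma monoid_formal_monoid: "monoid formal_monoid"
  by (rule monoidI) (auto simp: formal_monoid_def fps_compose_assoc)

lemma formal_group_eq_units: "formal_group = units_of formal_monoid"
proof -
  have "{s \<in> carrier formal_monoid. fps_nth s 1 \<noteq> 0} = Units formal_monoid"
  proof (intro equalityI subsetI)
    fix s assume "s \<in> {s \<in> carrier formal_monoid. fps_nth s 1 \<noteq> 0}"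
    then have s: "fps_nth s 0 = 0" "fps_nth s 1 \<noteq> 0"
      by (auto simp: formal_monoid_def)
    then have "fps_compose (fps_inv s) s = fps_X" "fps_compose s (fps_inv s) = fps_X"
      by (rule fps_inv, rule fps_inv_right)
    moreover have "fps_nth (fps_inv s) 0 = 0"
      by (simp add: fps_inv_def)
    ultimately show "s \<in> Units formal_monoid"
      using s by (auto simp: Units_def formal_monoid_def)
  next
    fix s assume "s \<in> Units formal_monoid"
    then obtain t where t: "fps_nth s 0 = 0" "fps_nth t 0 = 0" "fps_compose s t = fps_X"
      by (auto simp: Units_def formal_monoid_def)
    have "fps_nth s 1 * fps_nth t 1 = 1"
      using fps_compose_nth_1[OF t(2), of s] t(3) by simp
    then show "s \<in> {s \<in> carrier formal_monoid. fps_nth s 1 \<noteq> 0}"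
      using t by (auto simp: formal_monoid_def)
  qed
  then show ?thesis
    by (simp add: formal_group_def units_of_def formal_monoid_def)
qed

lemma group_formal_group: "group formal_group"
  unfolding formal_group_eq_units by (rule monoid.units_group[OF monoid_formal_monoid])

end

theory Submission
  imports Defs "HOL-Analysis.Function_Topology"
begin

text \<open>
  A nonempty set of rational series that generates \<open>G\<close> as a group also generates a rational
  semigroup \<open>S \<subseteq> G\<close>, and \<open>G\<close> is the group generated by \<open>S\<close>. The argument shows that \<open>S\<close> is right amenable and that
  right amenability passes from \<open>S\<close> to \<open>G\<close>.

  If \<open>S\<close> is not cyclic, it is right amenable by hypothesis. If it is cyclic, it consists of
  the powers \<open>x\<^sup>k\<^sup>+\<^sup>1\<close> of one element. The natural numbers carry a shift invariant mean, obtained by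
  compactness as a cluster point of the means over initial segments (\<open>ex_shift_invariant_mean\<close>);
  pushed forward along \<open>k \<mapsto> x\<^sup>k\<^sup>+\<^sup>1\<close>, it becomes right invariant, because multiplication by \<open>x\<close> is the
  shift of exponents (\<open>right_amenable_cyclic\<close>).

  Passing from \<open>S\<close> to \<open>G\<close> is easy because invariance concerns preimages
  (\<open>right_amenable_generate\<close>). Push a right invariant measure on \<open>S\<close> forward along the inclusion
  into \<open>G\<close>. Right translation by \<open>\<gamma> \<in> S\<close> maps \<open>S\<close> into itself, so the extended measure is still
  invariant under it; and the elements of \<open>G\<close> under which a measure on \<open>G\<close> is right invariant form
  a subgroup, which contains \<open>S\<close> and hence is all of \<open>G\<close>. Inversion finally turns a right invariant
  measure on the group \<open>G\<close> into a left invariant one.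
\<close>

lemma finitely_additive_probability_image:
  assumes "finitely_additive_probability S \<mu>" and "f \<in> S \<rightarrow> T"
  shows "finitely_additive_probability T (\<lambda>A. \<mu> {s \<in> S. f s \<in> A})"
proof -
  have "{s \<in> S. f s \<in> T} = S"
    using assms(2) by auto
  moreover have "\<mu> {s \<in> S. f s \<in> A \<union> B} = \<mu> {s \<in> S. f s \<in> A} + \<mu> {s \<in> S. f s \<in> B}"
    if "A \<inter> B = {}" for A B
  proof -
    have "{s \<in> S. f s \<in> A \<union> B} = {s \<in> S. f s \<in> A} \<union> {s \<in> S. f s \<in> B}"
      by auto
    moreover have "{s \<in> S. f s \<in> A} \<inter> {s \<in> S. f s \<in> B} = {}"
      using that by auto
    ultimately show ?thesis
      using assms(1) by (simp add: finitely_additive_probability_def additive_def)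
  qed
  ultimately show ?thesis
    using assms(1) by (simp add: finitely_additive_probability_def additive_def)
qed

lemma closed_contains_cluster_point:
  assumes "inf (nhds x) F \<noteq> bot" and "closed C" and "eventually (\<lambda>y. y \<in> C) F"
  shows "x \<in> C"
proof (rule ccontr)
  assume "x \<notin> C"
  then have "eventually (\<lambda>y. y \<in> - C) (nhds x)"
    using assms(2) by (intro eventually_nhds_in_open) auto
  with assms(3) have "eventually (\<lambda>y. False) (inf (nhds x) F)"
    unfolding eventually_inf by (intro exI[of _ "\<lambda>y. y \<in> - C"] exI[of _ "\<lambda>y. y \<in> C"]) auto
  with assms(1) show False
    by (simp add: eventually_False)
qed

text \<open>The uniform measures \<open>m n\<close> on \<open>{0, \<dots>, n}\<close> lie in the cube \<open>[0, 1]\<close> to the power of all sets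
  of natural numbers, which is compact for pointwise convergence, so they have a cluster point
  there. Each axiom of a mean is a closed condition satisfied by all \<open>m n\<close>, and shift invariance is
  the intersection of closed conditions that hold for all large \<open>n\<close>, as a shift changes \<open>m n\<close> by at
  most \<open>1 / (n + 1)\<close>.\<close>

lemma ex_shift_invariant_mean:
  "\<exists>\<mu> :: nat set \<Rightarrow> real. finitely_additive_probability UNIV \<mu> \<and> (\<forall>A. \<mu> {k. Suc k \<in> A} = \<mu> A)"
proof -
  define m :: "nat \<Rightarrow> nat set \<Rightarrow> real" where "m n A = real (card (A \<inter> {..n})) / real (Suc n)" for n A
  define F where "F = filtermap m sequentially"
  let ?K = "PiE UNIV (\<lambda>_ :: nat set. {0..1 :: real})"
  have m_le: "m n A \<le> 1" for n A
  proof -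
    have "card (A \<inter> {..n}) \<le> card {..n}"
      by (intro card_mono) auto
    then show ?thesis
      by (simp add: m_def)
  qed
  have m_nonneg: "0 \<le> m n A" for n A
    by (simp add: m_def)
  have m_UNIV: "m n UNIV = 1" for n
    by (simp add: m_def)
  have m_Un: "m n (A \<union> B) = m n A + m n B" if "A \<inter> B = {}" for n A B
  proof -
    have "card ((A \<union> B) \<inter> {..n}) = card (A \<inter> {..n}) + card (B \<inter> {..n})"
      using that by (subst card_Un_disjoint[symmetric]) (auto simp: Int_Un_distrib2)
    then show ?thesis
      by (simp add: m_def add_divide_distrib)
  qed
  have m_shift: "\<bar>m n {k. Suc k \<in> A} - m n A\<bar> \<le> 1 / real (Suc n)" for n A
  proof -
    (* The shift identifies the first window with A \<inter> {1, \<dots>, n + 1}, which differs from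
       A \<inter> {0, \<dots>, n} at most in the endpoints 0 and n + 1. *)
    let ?C = "A \<inter> {1..n}"
    have "card ({k. Suc k \<in> A} \<inter> {..n}) = card (Suc ` ({k. Suc k \<in> A} \<inter> {..n}))"
      by (simp add: card_image)
    also have "Suc ` ({k. Suc k \<in> A} \<inter> {..n}) = A \<inter> {1..Suc n}"
    proof (rule Set.set_eqI)
      show "j \<in> Suc ` ({k. Suc k \<in> A} \<inter> {..n}) \<longleftrightarrow> j \<in> A \<inter> {1..Suc n}" for j
        by (cases j) auto
    qed
    also have "A \<inter> {1..Suc n} = ?C \<union> (A \<inter> {Suc n})"
      by (auto simp: le_Suc_eq)
    also have "card \<dots> = card ?C + card (A \<inter> {Suc n})"
      by (intro card_Un_disjoint) auto
    finally have 1: "card ({k. Suc k \<in> A} \<inter> {..n}) = card ?C + card (A \<inter> {Suc n})" .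
    have "{..n} = {1..n} \<union> {0}"
      by auto
    then have "A \<inter> {..n} = ?C \<union> (A \<inter> {0})"
      by blast
    also have "card \<dots> = card ?C + card (A \<inter> {0})"
      by (intro card_Un_disjoint) auto
    finally have 2: "card (A \<inter> {..n}) = card ?C + card (A \<inter> {0})" .
    have le1: "card (A \<inter> {j}) \<le> 1" for j
      using card_mono[of "{j}" "A \<inter> {j}"] by simp
    have "m n {k. Suc k \<in> A} - m n A
        = (real (card (A \<inter> {Suc n})) - real (card (A \<inter> {0}))) / real (Suc n)"
      unfolding m_def 1 2 by (simp add: diff_divide_distrib[symmetric])
    moreover have "\<bar>real (card (A \<inter> {Suc n})) - real (card (A \<inter> {0}))\<bar> \<le> 1"
      using le1[of "Suc n"] le1[of 0] by linarith
    ultimately show ?thesis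
      by (simp add: abs_divide divide_right_mono)
  qed
  have "compact ?K"
    unfolding compactin_euclidean_iff[symmetric] euclidean_product_topology[symmetric]
    by (subst compactin_PiE) simp
  moreover have "F \<noteq> bot"
    by (simp add: F_def filtermap_bot_iff)
  moreover have "eventually (\<lambda>f. f \<in> ?K) F"
    by (simp add: F_def eventually_filtermap PiE_iff m_le m_nonneg)
  ultimately obtain \<mu> where cluster: "inf (nhds \<mu>) F \<noteq> bot"
    unfolding compact_filter by blast
  have limit: "P \<mu>" if "closed {f. P f}" "eventually (\<lambda>n. P (m n)) sequentially" for P
    using closed_contains_cluster_point[OF cluster that(1)] that(2)
    by (simp add: F_def eventually_filtermap)
  note closed_intros = closed_Collect_le closed_Collect_eq continuous_on_const continuous_on_add
    continuous_on_diff continuous_on_rabs continuous_on_product_coordinates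
  have nonneg: "0 \<le> \<mu> A" for A
    by (rule limit[of "\<lambda>f. 0 \<le> f A"]) (intro closed_intros, simp add: m_nonneg)
  have UNIV: "\<mu> UNIV = 1"
    by (rule limit[of "\<lambda>f. f UNIV = 1"]) (intro closed_intros, simp add: m_UNIV)
  have Un: "\<mu> (A \<union> B) = \<mu> A + \<mu> B" if "A \<inter> B = {}" for A B
    by (rule limit[of "\<lambda>f. f (A \<union> B) = f A + f B"])
      (intro closed_intros, simp add: m_Un[OF that])
  have "\<bar>\<mu> {k. Suc k \<in> A} - \<mu> A\<bar> \<le> \<epsilon>" if "\<epsilon> > 0" for \<epsilon> A
  proof (rule limit[of "\<lambda>f. \<bar>f {k. Suc k \<in> A} - f A\<bar> \<le> \<epsilon>"])
    have "eventually (\<lambda>n. 1 / real (Suc n) < \<epsilon>) sequentially"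
      using that LIMSEQ_inverse_real_of_nat
      by (auto dest: order_tendstoD(2) simp: inverse_eq_divide)
    then show "eventually (\<lambda>n. \<bar>m n {k. Suc k \<in> A} - m n A\<bar> \<le> \<epsilon>) sequentially"
      by eventually_elim (rule order_trans[OF m_shift less_imp_le])
  qed (intro closed_intros)
  then have shift: "\<mu> {k. Suc k \<in> A} = \<mu> A" for A
    using field_le_epsilon[of "\<bar>\<mu> {k. Suc k \<in> A} - \<mu> A\<bar>" 0] by auto
  show ?thesis
    using nonneg UNIV Un shift
    by (auto simp: finitely_additive_probability_def additive_def intro!: exI[of _ \<mu>])
qed

lemma (in monoid) semigroup_generate_subset:
  assumes "X \<subseteq> T" and "\<And>a b. \<lbrakk>a \<in> T; b \<in> T\<rbrakk> \<Longrightarrow> a \<otimes> b \<in> T"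
  shows "semigroup_generate G X \<subseteq> T"
proof
  fix s assume "s \<in> semigroup_generate G X"
  then show "s \<in> T"
    by induction (use assms in auto)
qed

lemma (in monoid) right_amenable_cyclic:
  assumes x: "x \<in> carrier G"
  shows "right_amenable (G\<lparr>carrier := semigroup_generate G {x}\<rparr>)"
proof -
  let ?S = "semigroup_generate G {x}"
  obtain \<mu> :: "nat set \<Rightarrow> real" where \<mu>: "finitely_additive_probability UNIV \<mu>"
    and shift: "\<And>A. \<mu> {k. Suc k \<in> A} = \<mu> A"
    using ex_shift_invariant_mean by blast
  define \<nu> where "\<nu> A = \<mu> {k. x [^] Suc k \<in> A}" for A
  have S: "?S \<subseteq> carrier G"
    using x by (intro semigroup_generate_subset) auto
  have powers: "x [^] Suc k \<in> ?S" for k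
  proof (induction k)
    case 0
    then show ?case
      using x by (simp add: semigroup_generate.base)
  next
    case (Suc k)
    then have "x [^] Suc k \<otimes> x \<in> ?S"
      by (rule semigroup_generate.mult) (simp add: semigroup_generate.base)
    then show ?case
      by simp
  qed
  then have "finitely_additive_probability ?S \<nu>"
    using finitely_additive_probability_image[OF \<mu>, of "\<lambda>k. x [^] Suc k" ?S]
    by (simp add: \<nu>_def[abs_def])
  moreover have "\<nu> {g \<in> ?S. g \<otimes> \<gamma> \<in> A} = \<nu> A" if "\<gamma> \<in> ?S" and "A \<subseteq> ?S" for \<gamma> A
    using that
  proof (induction arbitrary: A)
    case (base y)
    then have "{k. x [^] Suc k \<in> {g \<in> ?S. g \<otimes> y \<in> A}} = {k. Suc k \<in> {j. x [^] Suc j \<in> A}}"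
      using powers by simp
    then show ?case
      unfolding \<nu>_def by (simp only: shift)
  next
    case (mult \<gamma> \<delta>)
    have "g \<otimes> \<gamma> \<in> ?S" "g \<otimes> (\<gamma> \<otimes> \<delta>) = g \<otimes> \<gamma> \<otimes> \<delta>" if "g \<in> ?S" for g
      using that mult.hyps S by (auto simp: m_assoc subset_iff semigroup_generate.mult)
    then have "\<nu> {g \<in> ?S. g \<otimes> (\<gamma> \<otimes> \<delta>) \<in> A} = \<nu> {g \<in> ?S. g \<otimes> \<gamma> \<in> {h \<in> ?S. h \<otimes> \<delta> \<in> A}}"
      by (intro arg_cong[of _ _ \<nu>]) auto
    also have "\<dots> = \<nu> {h \<in> ?S. h \<otimes> \<delta> \<in> A}"
      by (rule mult.IH(1)) auto
    also have "\<dots> = \<nu> A"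
      using mult.prems by (rule mult.IH(2))
    finally show ?case .
  qed
  ultimately show ?thesis
    unfolding right_amenable_def by (intro exI[of _ \<nu>]) auto
qed

text \<open>The measure on the generated group is the push-forward along the inclusion. Invariance under
  \<open>\<gamma> \<in> S\<close> is inherited, because \<open>g \<gamma> \<in> S\<close> for all \<open>g \<in> S\<close>; invariance under \<open>\<gamma>\<inverse>\<close> follows by applying
  invariance under \<open>\<gamma>\<close> to the set \<open>A \<gamma>\<close>, whose preimage under right translation by \<open>\<gamma>\<close> is \<open>A\<close>.\<close>

lemma (in group) right_amenable_generate:
  assumes S: "S \<subseteq> carrier G"
    and closed: "\<And>a b. \<lbrakk>a \<in> S; b \<in> S\<rbrakk> \<Longrightarrow> a \<otimes> b \<in> S"
    and amenable: "right_amenable (G\<lparr>carrier := S\<rparr>)"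
  shows "right_amenable (G\<lparr>carrier := generate G S\<rparr>)"
proof -
  let ?H = "generate G S"
  obtain \<mu> where \<mu>: "finitely_additive_probability S \<mu>"
    and inv: "\<And>A \<gamma>. \<lbrakk>A \<subseteq> S; \<gamma> \<in> S\<rbrakk> \<Longrightarrow> \<mu> {g \<in> S. g \<otimes> \<gamma> \<in> A} = \<mu> A"
    using amenable by (auto simp: right_amenable_def)
  define \<nu> where "\<nu> A = \<mu> {g \<in> S. g \<in> A}" for A
  have H: "g \<in> carrier G" if "g \<in> ?H" for g
    using generate_in_carrier[OF S that] .
  have sub: "S \<subseteq> ?H"
    by (auto intro: generate.incl)
  have prob: "finitely_additive_probability ?H \<nu>"
    using finitely_additive_probability_image[OF \<mu>, of "\<lambda>g. g" ?H] sub
    by (auto simp: \<nu>_def[abs_def])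
  have inv_S: "\<nu> {g \<in> ?H. g \<otimes> \<gamma> \<in> A} = \<nu> A" if "\<gamma> \<in> S" for \<gamma> A
  proof -
    have "{g \<in> S. g \<in> {g \<in> ?H. g \<otimes> \<gamma> \<in> A}} = {g \<in> S. g \<otimes> \<gamma> \<in> {g \<in> S. g \<in> A}}"
      using sub closed that by auto
    then show ?thesis
      unfolding \<nu>_def using inv[of "{g \<in> S. g \<in> A}" \<gamma>] that by auto
  qed
  have "\<nu> {g \<in> ?H. g \<otimes> \<gamma> \<in> A} = \<nu> A" if "\<gamma> \<in> ?H" and "A \<subseteq> ?H" for \<gamma> A
    using that
  proof (induction arbitrary: A)
    case one
    then have "{g \<in> ?H. g \<otimes> \<one> \<in> A} = A"
      using H by auto
    then show ?case
      by simp
  next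
    case (incl \<gamma>)
    then show ?case
      by (simp add: inv_S)
  next
    case (inv \<gamma>)
    let ?B = "{g \<in> ?H. g \<otimes> inv \<gamma> \<in> A}"
    have \<gamma>: "\<gamma> \<in> ?H" "\<gamma> \<in> carrier G"
      using inv S by (auto intro: generate.incl)
    have "g \<otimes> \<gamma> \<in> ?H" "g \<otimes> \<gamma> \<otimes> inv \<gamma> = g" if "g \<in> ?H" for g
      using H[OF that] \<gamma> by (simp_all add: m_assoc generate.eng[OF that])
    then have "{g \<in> ?H. g \<otimes> \<gamma> \<in> ?B} = A"
      using inv.prems by auto
    then show ?case
      using inv_S[OF inv.hyps, of ?B] by simp
  next
    case (eng \<gamma> \<delta>)
    have "g \<otimes> \<gamma> \<in> ?H" "g \<otimes> (\<gamma> \<otimes> \<delta>) = g \<otimes> \<gamma> \<otimes> \<delta>" if "g \<in> ?H" for g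
      using that eng.hyps H by (auto simp: m_assoc generate.eng)
    then have "\<nu> {g \<in> ?H. g \<otimes> (\<gamma> \<otimes> \<delta>) \<in> A} = \<nu> {g \<in> ?H. g \<otimes> \<gamma> \<in> {h \<in> ?H. h \<otimes> \<delta> \<in> A}}"
      by (intro arg_cong[of _ _ \<nu>]) auto
    also have "\<dots> = \<nu> {h \<in> ?H. h \<otimes> \<delta> \<in> A}"
      by (rule eng.IH(1)) auto
    also have "\<dots> = \<nu> A"
      using eng.prems by (rule eng.IH(2))
    finally show ?case .
  qed
  then show ?thesis
    using prob unfolding right_amenable_def by (intro exI[of _ \<nu>]) auto
qed

lemma (in group) amenable_if_right_amenable:
  assumes "right_amenable G"
  shows "amenable G"
proof -
  obtain \<mu> where \<mu>: "finitely_additive_probability (carrier G) \<mu>"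
    and inv: "\<And>A \<gamma>. \<lbrakk>A \<subseteq> carrier G; \<gamma> \<in> carrier G\<rbrakk> \<Longrightarrow> \<mu> {g \<in> carrier G. g \<otimes> \<gamma> \<in> A} = \<mu> A"
    using assms by (auto simp: right_amenable_def)
  define \<nu> where "\<nu> A = \<mu> {g \<in> carrier G. inv g \<in> A}" for A
  have "finitely_additive_probability (carrier G) \<nu>"
    using finitely_additive_probability_image[OF \<mu>, of "\<lambda>g. inv g" "carrier G"]
    by (auto simp: \<nu>_def[abs_def])
  moreover have "\<nu> {g \<in> carrier G. \<gamma> \<otimes> g \<in> A} = \<nu> A" if "\<gamma> \<in> carrier G" for \<gamma> A
  proof -
    (* \<gamma> g\<inverse> = (g \<gamma>\<inverse>)\<inverse>: inversion turns left translation by \<gamma> into right translation by \<gamma>\<inverse>. *)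
    have "{g \<in> carrier G. inv g \<in> {g \<in> carrier G. \<gamma> \<otimes> g \<in> A}}
        = {g \<in> carrier G. g \<otimes> inv \<gamma> \<in> {g \<in> carrier G. inv g \<in> A}}"
      using that by (auto simp: inv_mult_group)
    then show ?thesis
      unfolding \<nu>_def using inv[of "{g \<in> carrier G. inv g \<in> A}" "inv \<gamma>"] that by auto
  qed
  ultimately have "left_amenable G"
    unfolding left_amenable_def by (intro exI[of _ \<nu>]) auto
  with assms show ?thesis
    by (simp add: amenable_def)
qed

theorem corollary7:
  fixes G :: "complex fps set"
  assumes "rational_group G"
    and "\<And>S. S \<subseteq> G \<Longrightarrow> rational_semigroup S \<Longrightarrow> \<not> cyclic_semigroup S \<Longrightarrow>
           right_amenable (formal_monoid\<lparr>carrier := S\<rparr>)"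
  shows "amenable (formal_group\<lparr>carrier := G\<rparr>)"
proof -
  interpret monoid formal_monoid
    by (rule monoid_formal_monoid)
  interpret \<Gamma>: group formal_group
    by (rule group_formal_group)
  obtain X where G: "subgroup G formal_group" and X: "X \<subseteq> rational_elements" "X \<subseteq> carrier formal_group"
    and G_eq: "G = generate formal_group X"
    using assms(1) by (auto simp: rational_group_def)
  have restrict: "formal_group\<lparr>carrier := S\<rparr> = formal_monoid\<lparr>carrier := S\<rparr>"
    and mult_eq: "(\<otimes>\<^bsub>formal_group\<^esub>) = (\<otimes>\<^bsub>formal_monoid\<^esub>)" for S
    by (simp_all add: formal_group_def)
  have carrier: "carrier formal_group \<subseteq> carrier formal_monoid"
    by (auto simp: formal_group_def)
  (* The trivial group may be given by the empty generating set, whose semigroup is empty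
     and carries no probability measure. Generated by the identity instead, it is a cyclic
     semigroup. *)
  define Y where "Y = (if X = {} then {\<one>\<^bsub>formal_group\<^esub>} else X)"
  define S where "S = semigroup_generate formal_monoid Y"
  have Y: "Y \<subseteq> G" "X \<subseteq> Y"
    using \<Gamma>.generate_incl[OF X(2)] subgroup.one_closed[OF G]
    by (auto simp: Y_def G_eq intro: generate.incl)
  have closed: "a \<otimes>\<^bsub>formal_group\<^esub> b \<in> S" if "a \<in> S" "b \<in> S" for a b
    using that by (simp add: S_def mult_eq semigroup_generate.mult)
  have "S \<subseteq> G"
    unfolding S_def using Y(1) subgroup.m_closed[OF G]
    by (intro semigroup_generate_subset) (auto simp: mult_eq)
  then have S: "S \<subseteq> carrier formal_group"
    using subgroup.subset[OF G] by blast
  have "right_amenable (formal_monoid\<lparr>carrier := S\<rparr>)"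
  proof (cases "cyclic_semigroup S")
    case True
    then show ?thesis
      using right_amenable_cyclic by (auto simp: cyclic_semigroup_def)
  next
    case False
    have "X \<noteq> {}"
    proof
      assume "X = {}"
      then have "S = semigroup_generate formal_monoid {\<one>\<^bsub>formal_group\<^esub>}"
        by (simp add: S_def Y_def)
      with False \<Gamma>.one_closed carrier show False
        unfolding cyclic_semigroup_def by blast
    qed
    then have "rational_semigroup S"
      using X by (auto simp: rational_semigroup_def S_def Y_def)
    then show ?thesis
      using assms(2) \<open>S \<subseteq> G\<close> False by blast
  qed
  then have "right_amenable (formal_group\<lparr>carrier := generate formal_group S\<rparr>)"
    using S closed by (intro \<Gamma>.right_amenable_generate) (auto simp: restrict)
  moreover have "generate formal_group S = G"
  proof
    show "generate formal_group S \<subseteq> G"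
      using \<open>S \<subseteq> G\<close> G by (rule \<Gamma>.generate_subgroup_incl)
    have "X \<subseteq> S"
      using Y(2) by (auto simp: S_def intro: semigroup_generate.base)
    then show "G \<subseteq> generate formal_group S"
      unfolding G_eq by (rule \<Gamma>.mono_generate)
  qed
  ultimately show ?thesis
    using group.amenable_if_right_amenable[OF \<Gamma>.subgroup_imp_group[OF G]] by simp
qed

end
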